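(* Let $q\in\mathbb{R}\setminus\{0,1,-1\}$, let $n\ge 1$ be an integer, let $(a_k)_{k\ge 0}$ and $(b_k)_{k\ge 0}$ be finitely supported sequences of complex numbers, and let $a=-\sum_{k\ge 0}(a_k+b_k)$. Let $D$ be the difference operator acting on functions $f:\mathbb{R}\to\mathbb{C}$ by $$Df(h)=a f(0)+\sum_{k\ge 0}\bigl(a_k f(q^kh)+b_k f(-q^kh)\bigr),$$ and let $$r^+(x)=\sum_{k\ge 0}(a_k+b_k)x^k,\qquad r^-(x)=\sum_{k\ge 0}(a_k-b_k)x^k.$$ Then $D$ has the Marcinkiewicz-Zygmund property of order $n$ if and only if all roots of $r^+(x)$ and of $r^-(x)$ lie outside the set $\mathcal{A}_q$, i.e. there is no $z\in\mathcal{A}_q$ with $r^+(z)=0$ or $r^-(z)=0$, where $$\mathcal{A}_q := \begin{cases}\{z\in\mathbb{C} : |q|^{n-1}<|z|\le |q|^n\}, & \text{if } |q|>1,\\ \{z\in\mathbb{C} : |q|^{n}\le|z|< |q|^{n-1}\}, & \text{if } 0<|q|<1.\end{cases}$$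
   Context: For a function $F:\mathbb{R}\to\mathbb{C}$ and an integer $m\ge 0$, $F(h)=o(h^m)$ means $\lim_{h\to 0}|F(h)|/|h|^m=0$ (limit over $h\neq 0$). The operator $D$ has the Marcinkiewicz-Zygmund (MZ) property of order $n$ if for all functions $f:\mathbb{R}\to\mathbb{C}$, the conditions $f(h)=o(h^{n-1})$ and $Df(h)=o(h^n)$ imply $f(h)=o(h^n)$. *)

theory Defs
  imports "HOL-Analysis.Analysis"
begin

definition little_o_pow :: "(real \<Rightarrow> complex) \<Rightarrow> nat \<Rightarrow> bool" where
  "little_o_pow F m \<longleftrightarrow> ((\<lambda>h. cmod (F h) / \<bar>h\<bar> ^ m) \<longlongrightarrow> 0) (at 0)"

text \<open>
  Only used for orders \<open>n \<ge> 1\<close>; the subtraction \<open>n - 1\<close> is on natural numbers.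
\<close>

definition MZ_property :: "((real \<Rightarrow> complex) \<Rightarrow> real \<Rightarrow> complex) \<Rightarrow> nat \<Rightarrow> bool" where
  "MZ_property D n \<longleftrightarrow>
     (\<forall>f. little_o_pow f (n - 1) \<and> little_o_pow (D f) n \<longrightarrow> little_o_pow f n)"

text \<open>
  The infinite sums below are used for finitely supported \<open>a\<close> and \<open>b\<close>, so that
  only finitely many summands are nonzero.
\<close>

definition diff_op ::
  "real \<Rightarrow> complex \<Rightarrow> (nat \<Rightarrow> complex) \<Rightarrow> (nat \<Rightarrow> complex) \<Rightarrow> (real \<Rightarrow> complex) \<Rightarrow> real \<Rightarrow> complex" where
  "diff_op q c a b f h =
     c * f 0 + (\<Sum>k. (a k * f (q ^ k * h) + b k * f (- (q ^ k * h))))"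

definition r_plus :: "(nat \<Rightarrow> complex) \<Rightarrow> (nat \<Rightarrow> complex) \<Rightarrow> complex \<Rightarrow> complex" where
  "r_plus a b x = (\<Sum>k. (a k + b k) * x ^ k)"

definition r_minus :: "(nat \<Rightarrow> complex) \<Rightarrow> (nat \<Rightarrow> complex) \<Rightarrow> complex \<Rightarrow> complex" where
  "r_minus a b x = (\<Sum>k. (a k - b k) * x ^ k)"

text \<open>The second branch is meant for \<open>0 < \<bar>q\<bar> < 1\<close>; the values \<open>q = 0, 1, -1\<close> are excluded.\<close>

definition annulus :: "real \<Rightarrow> nat \<Rightarrow> complex set" where
  "annulus q n =
     (if \<bar>q\<bar> > 1 then {z. \<bar>q\<bar> ^ (n - 1) < cmod z \<and> cmod z \<le> \<bar>q\<bar> ^ n}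
      else {z. \<bar>q\<bar> ^ n \<le> cmod z \<and> cmod z < \<bar>q\<bar> ^ (n - 1)})"

end

theory Submission
  imports Defs "HOL-Computational_Algebra.Fundamental_Theorem_Algebra"
begin

text \<open>
  Splitting \<open>f\<close> into even and odd parts \<open>F\<close> and \<open>G\<close> turns \<open>D f = o(h\<^sup>n)\<close> into
  \<open>r\<^sup>+(T) F = o(h\<^sup>n)\<close> and \<open>r\<^sup>-(T) G = o(h\<^sup>n)\<close>, where \<open>T f(h) = f(q h)\<close>.
  Factoring over the complex numbers reduces sufficiency to a single factor \<open>T - z\<close>, which is
  inverted by iterating the functional equation towards \<open>0\<close> or away from \<open>0\<close>, depending on the
  side of the annulus on which \<open>z\<close> lies. For necessity, a root \<open>z\<close> in the annulus gives an even or
  odd eigenfunction of \<open>T\<close> with eigenvalue \<open>z\<close> and modulus \<open>\<bar>h\<bar>\<close> to the power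
  \<open>ln \<bar>z\<bar> / ln \<bar>q\<bar>\<close>, an exponent in the interval \<open>(n - 1, n]\<close>.
\<close>

section \<open>Functions of order \<open>o(h\<^sup>m)\<close>\<close>

text \<open>Clearing the denominator and allowing a non-strict bound gives the form in which the
  iterated estimates come out; halving \<open>e\<close> recovers the strict inequality of the
  limit.\<close>

lemma little_o_pow_iff:
  "little_o_pow F m \<longleftrightarrow>
     (\<forall>e>0. \<exists>d>0. \<forall>h. h \<noteq> 0 \<and> \<bar>h\<bar> < d \<longrightarrow> cmod (F h) \<le> e * \<bar>h\<bar> ^ m)"
proof -
  have "little_o_pow F m \<longleftrightarrow>
      (\<forall>e>0. \<exists>d>0. \<forall>h. h \<noteq> 0 \<and> \<bar>h\<bar> < d \<longrightarrow> cmod (F h) / \<bar>h\<bar> ^ m < e)"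
    by (simp add: little_o_pow_def tendsto_iff eventually_at dist_real_def)
  also have "\<dots> \<longleftrightarrow> (\<forall>e>0. \<exists>d>0. \<forall>h. h \<noteq> 0 \<and> \<bar>h\<bar> < d \<longrightarrow> cmod (F h) / \<bar>h\<bar> ^ m \<le> e)"
    (is "?L \<longleftrightarrow> ?R")
  proof
    show ?R if ?L using that by (meson less_imp_le)
    show ?L if R: ?R
    proof (intro allI impI)
      fix e :: real assume "e > 0"
      then obtain d where "d > 0" "\<forall>h. h \<noteq> 0 \<and> \<bar>h\<bar> < d \<longrightarrow> cmod (F h) / \<bar>h\<bar> ^ m \<le> e / 2"
        using R by (meson half_gt_zero)
      then show "\<exists>d>0. \<forall>h. h \<noteq> 0 \<and> \<bar>h\<bar> < d \<longrightarrow> cmod (F h) / \<bar>h\<bar> ^ m < e"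
        using \<open>e > 0\<close> by (smt (verit) field_sum_of_halves)
    qed
  qed
  finally show ?thesis
    by (simp add: divide_le_eq mult.commute cong: conj_cong)
qed

lemma little_o_powD:
  assumes "little_o_pow F m" "e > 0"
  obtains d where "d > 0" "\<And>h. h \<noteq> 0 \<Longrightarrow> \<bar>h\<bar> < d \<Longrightarrow> cmod (F h) \<le> e * \<bar>h\<bar> ^ m"
  using assms unfolding little_o_pow_iff by blast

lemma little_o_pow_add:
  assumes "little_o_pow F m" "little_o_pow G m"
  shows "little_o_pow (\<lambda>h. F h + G h) m"
  unfolding little_o_pow_def
proof (rule Lim_null_comparison)
  show "((\<lambda>h. cmod (F h) / \<bar>h\<bar> ^ m + cmod (G h) / \<bar>h\<bar> ^ m) \<longlongrightarrow> 0) (at 0)"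
    using tendsto_add[OF assms[unfolded little_o_pow_def]] by simp
  show "\<forall>\<^sub>F h in at 0. norm (cmod (F h + G h) / \<bar>h\<bar> ^ m) \<le>
      cmod (F h) / \<bar>h\<bar> ^ m + cmod (G h) / \<bar>h\<bar> ^ m"
    by (intro always_eventually allI)
      (simp add: norm_triangle_ineq divide_right_mono flip: add_divide_distrib)
qed

lemma little_o_pow_cmult:
  assumes "little_o_pow F m"
  shows "little_o_pow (\<lambda>h. w * F h) m"
  using tendsto_mult_left[OF assms[unfolded little_o_pow_def], of "cmod w"]
  by (simp add: little_o_pow_def norm_mult)

lemma little_o_pow_diff:
  assumes "little_o_pow F m" "little_o_pow G m"
  shows "little_o_pow (\<lambda>h. F h - G h) m"
  using little_o_pow_add[OF assms(1) little_o_pow_cmult[OF assms(2), of "-1"]] by simp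

lemma little_o_pow_sum:
  assumes "\<And>i. i \<in> A \<Longrightarrow> little_o_pow (F i) m"
  shows "little_o_pow (\<lambda>h. \<Sum>i\<in>A. F i h) m"
  using assms
proof (induction A rule: infinite_finite_induct)
  case (insert i A)
  then show ?case by (simp add: little_o_pow_add)
qed (simp_all add: little_o_pow_def)

lemma little_o_pow_scale:
  assumes "little_o_pow F m" "r \<noteq> 0"
  shows "little_o_pow (\<lambda>h. F (r * h)) m"
  unfolding little_o_pow_iff
proof (intro allI impI)
  fix e :: real assume "e > 0"
  obtain d where d: "d > 0"
    and F: "\<And>h. h \<noteq> 0 \<Longrightarrow> \<bar>h\<bar> < d \<Longrightarrow> cmod (F h) \<le> (e / \<bar>r\<bar> ^ m) * \<bar>h\<bar> ^ m"
    using little_o_powD[OF assms(1), of "e / \<bar>r\<bar> ^ m"] \<open>e > 0\<close> assms(2)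
    by (metis divide_pos_pos zero_less_abs_iff zero_less_power)
  have "cmod (F (r * h)) \<le> e * \<bar>h\<bar> ^ m" if "h \<noteq> 0" "\<bar>h\<bar> < d / \<bar>r\<bar>" for h
    using F[of "r * h"] that assms(2)
    by (simp add: abs_mult power_mult_distrib less_divide_eq mult.commute)
  then show "\<exists>d>0. \<forall>h. h \<noteq> 0 \<and> \<bar>h\<bar> < d \<longrightarrow> cmod (F (r * h)) \<le> e * \<bar>h\<bar> ^ m"
    using d assms(2) by (intro exI[of _ "d / \<bar>r\<bar>"]) auto
qed

lemma little_o_pow_mono:
  assumes "little_o_pow F m" "k \<le> m"
  shows "little_o_pow F k"
  unfolding little_o_pow_iff
proof (intro allI impI)
  fix e :: real assume "e > 0"
  then obtain d where d: "d > 0"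
    and F: "\<And>h. h \<noteq> 0 \<Longrightarrow> \<bar>h\<bar> < d \<Longrightarrow> cmod (F h) \<le> e * \<bar>h\<bar> ^ m"
    using little_o_powD[OF assms(1)] by blast
  have "cmod (F h) \<le> e * \<bar>h\<bar> ^ k" if "h \<noteq> 0" "\<bar>h\<bar> < min d 1" for h
  proof -
    have "\<bar>h\<bar> ^ m \<le> \<bar>h\<bar> ^ k"
      using that assms(2) by (intro power_decreasing) auto
    then show ?thesis
      using F[of h] that \<open>e > 0\<close> by (smt (verit) mult_left_mono)
  qed
  then show "\<exists>d>0. \<forall>h. h \<noteq> 0 \<and> \<bar>h\<bar> < d \<longrightarrow> cmod (F h) \<le> e * \<bar>h\<bar> ^ k"
    using d by (intro exI[of _ "min d 1"]) auto
qed

text \<open>Isolates the value at 0: it is applied to the term \<open>c * f 0\<close> of the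
  difference operator.\<close>

lemma little_o_pow_constD:
  assumes "little_o_pow (\<lambda>_. w) m"
  shows "w = 0"
proof -
  have "little_o_pow (\<lambda>_. w) 0"
    using little_o_pow_mono[OF assms] by simp
  then have "((\<lambda>h::real. cmod w) \<longlongrightarrow> 0) (at 0)"
    by (simp add: little_o_pow_def)
  then show ?thesis
    by (simp add: tendsto_const_iff)
qed

section \<open>A single linear factor\<close>

text \<open>Unroll g(h) = w g(s h) + error towards 0. The errors add up geometrically with ratio
  \<open>cmod w * \<bar>s\<bar> ^ n\<close>, which is below 1. The remainder after N steps tends to
  0 because g = o(h^(n-1)), even if \<open>cmod w * \<bar>s\<bar> ^ (n - 1)\<close> equals
  1.\<close>

lemma little_o_pow_iterate_inward:
  fixes s :: real and w :: complex
  assumes s: "s \<noteq> 0" "\<bar>s\<bar> < 1" and "n \<ge> 1"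
    and w: "cmod w * \<bar>s\<bar> ^ (n - 1) \<le> 1"
    and g: "little_o_pow g (n - 1)"
    and e: "little_o_pow (\<lambda>h. g h - w * g (s * h)) n"
  shows "little_o_pow g n"
  unfolding little_o_pow_iff
proof (intro allI impI)
  fix \<epsilon> :: real assume "\<epsilon> > 0"
  define r where "r = cmod w * \<bar>s\<bar> ^ n"
  have "r = cmod w * \<bar>s\<bar> ^ (n - 1) * \<bar>s\<bar>"
    using \<open>n \<ge> 1\<close> by (simp add: r_def mult.assoc flip: power_Suc2)
  also have "\<dots> \<le> 1 * \<bar>s\<bar>"
    using w by (intro mult_right_mono) auto
  finally have "r < 1" using s by simp
  \<comment> \<open>The factor 1 - r is chosen so that the error plus
    \<open>cmod w * (\<epsilon> * \<bar>s * h\<bar> ^ n)\<close> is at most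
    \<open>\<epsilon> * \<bar>h\<bar> ^ n\<close>. The excess of \<open>cmod (g h)\<close> over this
    bound then obeys a recursion without error term.\<close>
  then obtain d where d: "d > 0"
    and E: "\<And>h. h \<noteq> 0 \<Longrightarrow> \<bar>h\<bar> < d \<Longrightarrow>
       cmod (g h - w * g (s * h)) \<le> (\<epsilon> * (1 - r)) * \<bar>h\<bar> ^ n"
    using little_o_powD[OF e, of "\<epsilon> * (1 - r)"] \<open>\<epsilon> > 0\<close>
    by (metis diff_gt_0_iff_gt mult_pos_pos)
  have step: "cmod (g h) - \<epsilon> * \<bar>h\<bar> ^ n \<le> cmod w * (cmod (g (s * h)) - \<epsilon> * \<bar>s * h\<bar> ^ n)"
    if "h \<noteq> 0" "\<bar>h\<bar> < d" for h
  proof -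
    have "cmod (g h) \<le> cmod (g h - w * g (s * h)) + cmod w * cmod (g (s * h))"
      by (metis norm_mult norm_triangle_sub add.commute)
    then show ?thesis
      using E[OF that] by (simp add: r_def abs_mult power_mult_distrib algebra_simps)
  qed
  have iter: "cmod (g h) - \<epsilon> * \<bar>h\<bar> ^ n \<le>
      cmod w ^ N * (cmod (g (s ^ N * h)) - \<epsilon> * \<bar>s ^ N * h\<bar> ^ n)"
    if "h \<noteq> 0" "\<bar>h\<bar> < d" for h N
  proof (induction N)
    case (Suc N)
    have "\<bar>s ^ N * h\<bar> \<le> 1 * \<bar>h\<bar>"
      unfolding abs_mult using s by (intro mult_right_mono) (auto simp: power_abs power_le_one)
    then have "cmod w ^ N * (cmod (g (s ^ N * h)) - \<epsilon> * \<bar>s ^ N * h\<bar> ^ n) \<le>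
        cmod w ^ N * (cmod w * (cmod (g (s * (s ^ N * h))) - \<epsilon> * \<bar>s * (s ^ N * h)\<bar> ^ n))"
      using that s by (intro mult_left_mono step) auto
    with Suc show ?case by (simp add: mult_ac)
  qed simp
  \<comment> \<open>Here \<open>h\<close> stays fixed while \<open>N\<close> depends on the slack
    \<eta>. Dividing \<eta> by \<open>\<bar>h\<bar> ^ (n - 1)\<close> cancels the power of
    \<open>h\<close> in the bound for \<open>g (s ^ N * h)\<close>.\<close>
  have "cmod (g h) \<le> \<epsilon> * \<bar>h\<bar> ^ n" if h: "h \<noteq> 0" "\<bar>h\<bar> < d" for h
  proof (rule field_le_epsilon)
    fix \<eta> :: real assume "\<eta> > 0"
    then obtain d' where d': "d' > 0"
      and G: "\<And>y. y \<noteq> 0 \<Longrightarrow> \<bar>y\<bar> < d' \<Longrightarrow> cmod (g y) \<le> (\<eta> / \<bar>h\<bar> ^ (n - 1)) * \<bar>y\<bar> ^ (n - 1)"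
      using little_o_powD[OF g, of "\<eta> / \<bar>h\<bar> ^ (n - 1)"] h(1)
      by (metis divide_pos_pos zero_less_abs_iff zero_less_power)
    obtain N where "\<bar>s\<bar> ^ N < d' / \<bar>h\<bar>"
      using real_arch_pow_inv[of "d' / \<bar>h\<bar>" "\<bar>s\<bar>"] d' h(1) s by auto
    then have "\<bar>s ^ N * h\<bar> < d'"
      using h(1) by (simp add: abs_mult power_abs less_divide_eq)
    then have "cmod (g (s ^ N * h)) \<le> (\<eta> / \<bar>h\<bar> ^ (n - 1)) * \<bar>s ^ N * h\<bar> ^ (n - 1)"
      using h(1) s by (intro G) auto
    also have "\<dots> = \<eta> * (\<bar>s\<bar> ^ (n - 1)) ^ N"
      using h(1) by (simp add: abs_mult power_mult_distrib power_abs flip: power_mult)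
        (simp add: mult.commute)
    finally have "cmod w ^ N * cmod (g (s ^ N * h)) \<le> cmod w ^ N * (\<eta> * (\<bar>s\<bar> ^ (n - 1)) ^ N)"
      by (intro mult_left_mono) auto
    also have "\<dots> = \<eta> * (cmod w * \<bar>s\<bar> ^ (n - 1)) ^ N"
      by (simp add: power_mult_distrib)
    also have "\<dots> \<le> \<eta> * 1"
      using w \<open>\<eta> > 0\<close> by (intro mult_left_mono power_le_one) auto
    finally have "cmod w ^ N * cmod (g (s ^ N * h)) \<le> \<eta>" by simp
    moreover have "0 \<le> cmod w ^ N * (\<epsilon> * \<bar>s ^ N * h\<bar> ^ n)"
      using \<open>\<epsilon> > 0\<close> by simp
    ultimately show "cmod (g h) \<le> \<epsilon> * \<bar>h\<bar> ^ n + \<eta>"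
      using iter[OF h, of N] by (simp add: right_diff_distrib)
  qed
  then show "\<exists>d>0. \<forall>h. h \<noteq> 0 \<and> \<bar>h\<bar> < d \<longrightarrow> cmod (g h) \<le> \<epsilon> * \<bar>h\<bar> ^ n"
    using d by blast
qed

text \<open>Unroll g(s h) = w g(h) + error away from 0 until the argument has a fixed order of
  magnitude. Boundedness of g suffices there, since N steps contribute \<open>cmod w ^ N\<close>,
  which is negligible against \<open>(\<bar>s\<bar> ^ n) ^ N\<close>.\<close>

lemma little_o_pow_iterate_outward:
  fixes s :: real and w :: complex
  assumes s: "s \<noteq> 0" "\<bar>s\<bar> < 1"
    and w: "cmod w < \<bar>s\<bar> ^ n"
    and g: "little_o_pow g 0"
    and e: "little_o_pow (\<lambda>h. g (s * h) - w * g h) n"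
  shows "little_o_pow g n"
  unfolding little_o_pow_iff
proof (intro allI impI)
  fix \<epsilon>' :: real assume "\<epsilon>' > 0"
  \<comment> \<open>One half of the bound pays for the accumulated errors, the other for the
    contribution \<open>cmod w ^ N\<close> of the far end.\<close>
  define \<epsilon> where "\<epsilon> = \<epsilon>' / 2"
  have "\<epsilon> > 0" using \<open>\<epsilon>' > 0\<close> by (simp add: \<epsilon>_def)
  \<comment> \<open>With this constant the error plus
    \<open>cmod w * (\<epsilon> * \<bar>h\<bar> ^ n)\<close> is at most
    \<open>\<epsilon> * \<bar>s * h\<bar> ^ n\<close>, which again makes the recursion for the
    excess free of errors.\<close>
  obtain d1 where d1: "d1 > 0"
    and E: "\<And>h. h \<noteq> 0 \<Longrightarrow> \<bar>h\<bar> < d1 \<Longrightarrow>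
       cmod (g (s * h) - w * g h) \<le> (\<epsilon> * (\<bar>s\<bar> ^ n - cmod w)) * \<bar>h\<bar> ^ n"
    using little_o_powD[OF e, of "\<epsilon> * (\<bar>s\<bar> ^ n - cmod w)"] \<open>\<epsilon> > 0\<close> w
    by (metis diff_gt_0_iff_gt mult_pos_pos)
  obtain d2 where d2: "d2 > 0" and G: "\<And>h. h \<noteq> 0 \<Longrightarrow> \<bar>h\<bar> < d2 \<Longrightarrow> cmod (g h) \<le> 1"
    using little_o_powD[OF g, of 1] by auto
  define d where "d = min d1 d2"
  have d: "d > 0" using d1 d2 by (simp add: d_def)
  have step: "cmod (g (s * h)) - \<epsilon> * \<bar>s * h\<bar> ^ n \<le> cmod w * (cmod (g h) - \<epsilon> * \<bar>h\<bar> ^ n)"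
    if "h \<noteq> 0" "\<bar>h\<bar> < d" for h
  proof -
    have "cmod (g (s * h)) \<le> cmod (g (s * h) - w * g h) + cmod w * cmod (g h)"
      by (metis norm_mult norm_triangle_sub add.commute)
    then show ?thesis
      using E[of h] that by (simp add: d_def abs_mult power_mult_distrib algebra_simps)
  qed
  have iter: "cmod (g h) - \<epsilon> * \<bar>h\<bar> ^ n \<le> cmod w ^ N" if "h \<noteq> 0" "\<bar>h\<bar> < \<bar>s\<bar> ^ N * d" for h N
    using that
  proof (induction N arbitrary: h)
    case 0
    have "0 \<le> \<epsilon> * \<bar>h\<bar> ^ n" using \<open>\<epsilon> > 0\<close> by simp
    with 0 G[of h] show ?case by (simp add: d_def)
  next
    case (Suc N)
    have small: "\<bar>h / s\<bar> < \<bar>s\<bar> ^ N * d"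
      using Suc.prems s by (simp add: divide_less_eq mult_ac)
    also have "\<dots> \<le> 1 * d"
      using s d by (intro mult_right_mono) (auto intro: power_le_one)
    finally have "\<bar>h / s\<bar> < d" by simp
    then have "cmod (g h) - \<epsilon> * \<bar>h\<bar> ^ n \<le> cmod w * (cmod (g (h / s)) - \<epsilon> * \<bar>h / s\<bar> ^ n)"
      using step[of "h / s"] Suc.prems s by simp
    also have "\<dots> \<le> cmod w * cmod w ^ N"
      using small Suc.prems s by (intro mult_left_mono Suc.IH) auto
    finally show ?case by simp
  qed
  \<comment> \<open>\<rho> is the gain per step over the decay of \<open>\<bar>h\<bar> ^ n\<close>;
    \<open>N0\<close> steps are enough to absorb the constant
    \<open>(\<bar>s\<bar> * d) ^ n\<close>.\<close>
  define \<rho> where "\<rho> = cmod w / \<bar>s\<bar> ^ n"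
  have \<rho>: "0 \<le> \<rho>" "\<rho> < 1"
    using w s by (auto simp: \<rho>_def)
  obtain N0 where N0: "\<rho> ^ N0 < \<epsilon> * (\<bar>s\<bar> * d) ^ n"
    using real_arch_pow_inv[of "\<epsilon> * (\<bar>s\<bar> * d) ^ n" \<rho>] \<rho> \<open>\<epsilon> > 0\<close> s d by auto
  have "cmod (g y) \<le> \<epsilon>' * \<bar>y\<bar> ^ n" if y: "y \<noteq> 0" "\<bar>y\<bar> < \<bar>s\<bar> ^ N0 * d" for y
  proof -
    obtain M where "\<bar>s\<bar> ^ M < \<bar>y\<bar> / d"
      using real_arch_pow_inv[of "\<bar>y\<bar> / d" "\<bar>s\<bar>"] y s d by auto
    then have M: "\<bar>s\<bar> ^ M * d \<le> \<bar>y\<bar>"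
      using d by (simp add: less_divide_eq)
    \<comment> \<open>With K = N + 1, minimality puts \<open>\<bar>y\<bar>\<close> between
      \<open>\<bar>s\<bar> ^ (N + 1) * d\<close> and \<open>\<bar>s\<bar> ^ N * d\<close>. The upper
      bound allows N steps outward, the lower one turns the result into a multiple of
      \<open>\<bar>y\<bar> ^ n\<close>; the extra factor \<open>\<bar>s\<bar>\<close> explains the
      choice of \<open>N0\<close>.\<close>
    define K where "K = (LEAST K. \<bar>s\<bar> ^ K * d \<le> \<bar>y\<bar>)"
    have K: "\<bar>s\<bar> ^ K * d \<le> \<bar>y\<bar>"
      unfolding K_def using M by (rule LeastI)
    have less_K: "\<bar>y\<bar> < \<bar>s\<bar> ^ N * d" if "N < K" for N
      using not_less_Least[of N] that unfolding K_def by force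
    have "N0 < K"
    proof (rule ccontr)
      assume "\<not> N0 < K"
      then have "\<bar>s\<bar> ^ N0 * d \<le> \<bar>s\<bar> ^ K * d"
        using s d by (intro mult_right_mono power_decreasing) auto
      with K y show False by simp
    qed
    then obtain N where N: "K = Suc N" "N0 \<le> N"
      by (metis Suc_pred less_Suc_eq_le gr_implies_not0 not_gr_zero)
    have "cmod w ^ N = \<rho> ^ N * (\<bar>s\<bar> ^ n) ^ N"
      using s by (simp add: \<rho>_def power_divide)
    also have "\<dots> \<le> \<rho> ^ N0 * (\<bar>s\<bar> ^ n) ^ N"
      using \<rho> N by (intro mult_right_mono power_decreasing) auto
    also have "\<dots> \<le> \<epsilon> * (\<bar>s\<bar> * d) ^ n * (\<bar>s\<bar> ^ n) ^ N"
      using N0 by (intro mult_right_mono) auto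
    also have "\<dots> = \<epsilon> * (\<bar>s\<bar> ^ K * d) ^ n"
      by (simp add: N power_mult_distrib mult_ac flip: power_mult)
    also have "\<dots> \<le> \<epsilon> * \<bar>y\<bar> ^ n"
      using K d \<open>\<epsilon> > 0\<close> by (intro mult_left_mono power_mono) auto
    finally show ?thesis
      using iter[OF y(1) less_K[of N]] N by (simp add: \<epsilon>_def)
  qed
  moreover have "\<bar>s\<bar> ^ N0 * d > 0" using s d by simp
  ultimately show "\<exists>d>0. \<forall>h. h \<noteq> 0 \<and> \<bar>h\<bar> < d \<longrightarrow> cmod (g h) \<le> \<epsilon>' * \<bar>h\<bar> ^ n"
    by blast
qed

text \<open>Take s to be whichever of q and 1/q is contracting, and w to be z or 1/z accordingly.
  The half-open boundary of the annulus matches the two iterations: inward allows equality, outward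
  needs a strict inequality.\<close>

lemma little_o_pow_linear_factor:
  fixes q :: real and z :: complex
  assumes q: "q \<notin> {0, 1, -1}" and n: "n \<ge> 1" and z: "z \<notin> annulus q n"
    and g: "little_o_pow g (n - 1)"
    and e: "little_o_pow (\<lambda>h. g (q * h) - z * g h) n"
  shows "little_o_pow g n"
proof -
  have g0: "little_o_pow g 0" using little_o_pow_mono[OF g] by simp
  \<comment> \<open>Replacing h by h/q expresses the same equation through the dilation by
    1/q.\<close>
  have e_inv: "little_o_pow (\<lambda>h. g h - z * g (inverse q * h)) n"
    using little_o_pow_scale[OF e, of "inverse q"] q by (simp add: mult.assoc[symmetric])
  have inv_q: "\<bar>inverse q\<bar> ^ k = inverse (\<bar>q\<bar> ^ k)" for k
    by (simp add: power_inverse)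
  have pos: "\<bar>q\<bar> ^ k > 0" for k using q by simp
  show ?thesis
  proof (cases "\<bar>q\<bar> > 1")
    case True
    have inv: "inverse q \<noteq> 0" "\<bar>inverse q\<bar> < 1"
      using True by (auto simp: inverse_less_1_iff)
    consider "cmod z \<le> \<bar>q\<bar> ^ (n - 1)" | "\<bar>q\<bar> ^ n < cmod z"
      using z True by (force simp: annulus_def)
    then show ?thesis
    proof cases
      case 1
      then have "cmod z * \<bar>inverse q\<bar> ^ (n - 1) \<le> 1"
        using pos[of "n - 1"] by (simp add: inv_q field_simps)
      then show ?thesis
        by (rule little_o_pow_iterate_inward[OF inv n _ g e_inv])
    next
      case 2
      then have "z \<noteq> 0" using pos[of n] by auto
      have "cmod (inverse z) < \<bar>inverse q\<bar> ^ n"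
        unfolding inv_q norm_inverse using 2 pos by (intro less_imp_inverse_less)
      moreover have "- inverse z * (x - z * y) = y - inverse z * x" for x y
        using \<open>z \<noteq> 0\<close> by (simp add: field_simps)
      then have "little_o_pow (\<lambda>h. g (inverse q * h) - inverse z * g h) n"
        using little_o_pow_cmult[OF e_inv, of "- inverse z"] by simp
      ultimately show ?thesis
        by (rule little_o_pow_iterate_outward[OF inv _ g0])
    qed
  next
    case False
    then have q1: "q \<noteq> 0" "\<bar>q\<bar> < 1" using q by auto
    consider "\<bar>q\<bar> ^ (n - 1) \<le> cmod z" | "cmod z < \<bar>q\<bar> ^ n"
      using z False by (force simp: annulus_def)
    then show ?thesis
    proof cases
      case 1
      then have "z \<noteq> 0" using pos[of "n - 1"] by (metis norm_zero not_le)
      have "cmod (inverse z) * \<bar>q\<bar> ^ (n - 1) \<le> 1"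
        using 1 \<open>z \<noteq> 0\<close> by (simp add: norm_inverse inverse_eq_divide norm_divide)
      moreover have "- inverse z * (x - z * y) = y - inverse z * x" for x y
        using \<open>z \<noteq> 0\<close> by (simp add: field_simps)
      then have "little_o_pow (\<lambda>h. g h - inverse z * g (q * h)) n"
        using little_o_pow_cmult[OF e, of "- inverse z"] by simp
      ultimately show ?thesis
        by (rule little_o_pow_iterate_inward[OF q1 n _ g])
    next
      case 2
      then show ?thesis
        by (rule little_o_pow_iterate_outward[OF q1 _ g0 e])
    qed
  qed
qed

section \<open>Polynomials in the dilation operator\<close>

text \<open>This is P(T) F for the dilation T F(h) = F(q h). Summing over all indices, not only up
  to the degree, matches the series in \<open>diff_op\<close>.\<close>

definition dilation_poly :: "real \<Rightarrow> complex poly \<Rightarrow> (real \<Rightarrow> complex) \<Rightarrow> real \<Rightarrow> complex" where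
  "dilation_poly q P F h = (\<Sum>k. coeff P k * F (q ^ k * h))"

lemma finite_coeff_support: "finite {k. coeff P k \<noteq> 0}"
  by (rule finite_subset[of _ "{..degree P}"]) (auto intro: le_degree)

lemma summable_finite_support:
  fixes u v :: "nat \<Rightarrow> complex"
  assumes "finite {k. u k \<noteq> 0}"
  shows "summable (\<lambda>k. u k * v k)"
  by (rule summable_finite[OF assms]) auto

lemmas summable_coeff = summable_finite_support[OF finite_coeff_support]

text \<open>Products of polynomials act as compositions, and the factor T - z is applied to F first,
  so that an induction over P can vary F.\<close>

lemma dilation_poly_linear_factor:
  "dilation_poly q ([:- z, 1:] * P) F h = dilation_poly q P (\<lambda>y. F (q * y) - z * F y) h"
proof -
  \<comment> \<open>Multiplication by x shifts the coefficients by one; the new coefficient at index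
    0 is zero, so dropping it costs nothing.\<close>
  have head: "(\<Sum>k. coeff (pCons 0 P) k * F (q ^ k * h)) = (\<Sum>k. coeff P k * F (q * (q ^ k * h)))"
    using suminf_split_head[OF summable_coeff[of "pCons 0 P" "\<lambda>k. F (q ^ k * h)"]]
    by (simp add: mult.assoc)
  have "dilation_poly q ([:- z, 1:] * P) F h =
      (\<Sum>k. coeff (pCons 0 P) k * F (q ^ k * h) - z * (coeff P k * F (q ^ k * h)))"
    by (simp add: dilation_poly_def algebra_simps)
  also have "\<dots> = (\<Sum>k. coeff P k * F (q * (q ^ k * h))) - z * (\<Sum>k. coeff P k * F (q ^ k * h))"
    by (simp add: suminf_diff[symmetric] suminf_mult[symmetric] summable_coeff summable_mult head)
  also have "\<dots> = dilation_poly q P (\<lambda>y. F (q * y) - z * F y) h"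
    by (simp add: dilation_poly_def suminf_diff[symmetric] suminf_mult[symmetric]
        summable_coeff summable_mult algebra_simps)
  finally show ?thesis .
qed

text \<open>Split off a root z of P = (x - z) Q. The induction hypothesis for Q and (T - z) F gives
  (T - z) F = o(h^n), and the single-factor result removes T - z.\<close>

lemma little_o_pow_dilation_polyD:
  fixes q :: real and P :: "complex poly"
  assumes q: "q \<notin> {0, 1, -1}" and n: "n \<ge> 1"
    and "P \<noteq> 0" "\<forall>z \<in> annulus q n. poly P z \<noteq> 0"
    and "little_o_pow F (n - 1)" "little_o_pow (dilation_poly q P F) n"
  shows "little_o_pow F n"
  using assms(3-)
proof (induction "degree P" arbitrary: P F)
  case 0
  then obtain w where P: "P = [:w:]" by (metis degree_eq_zeroE)
  have "dilation_poly q P F h = w * F h" for h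
    unfolding dilation_poly_def P
    by (subst suminf_finite[of "{0}"]) (auto simp: coeff_pCons split: nat.split)
  then have "little_o_pow (\<lambda>h. w * F h) n"
    using "0.prems"(4) by presburger
  moreover have "w \<noteq> 0" using "0.prems"(1) P by simp
  ultimately show ?case
    using little_o_pow_cmult[of "\<lambda>h. w * F h" n "inverse w"]
    by (simp flip: mult.assoc)
next
  case (Suc d)
  then obtain z where z: "poly P z = 0"
    by (metis fundamental_theorem_of_algebra constant_degree nat.distinct(1))
  then obtain Q where P: "P = [:- z, 1:] * Q"
    by (auto simp: poly_eq_0_iff_dvd)
  let ?G = "\<lambda>h. F (q * h) - z * F h"
  have Q: "Q \<noteq> 0" using Suc.prems P by auto
  then have deg: "degree P = Suc (degree Q)"
    unfolding P by (subst degree_mult_eq) auto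
  have "little_o_pow ?G n"
  proof (rule Suc.hyps(1))
    show "little_o_pow (dilation_poly q Q ?G) n"
      using Suc.prems(4) unfolding P dilation_poly_linear_factor[abs_def] by simp
    show "little_o_pow ?G (n - 1)"
      using q Suc.prems(3) by (intro little_o_pow_diff little_o_pow_cmult little_o_pow_scale) auto
  qed (use Suc deg Q P in auto)
  then show ?case
    using little_o_pow_linear_factor[OF q n _ Suc.prems(3)] z Suc.prems(2) by blast
qed

lemma little_o_pow_of_dilation_sum:
  fixes q :: real and u :: "nat \<Rightarrow> complex"
  assumes q: "q \<notin> {0, 1, -1}" and n: "n \<ge> 1" and fin: "finite {k. u k \<noteq> 0}"
    and roots: "\<And>z. z \<in> annulus q n \<Longrightarrow> (\<Sum>k. u k * z ^ k) \<noteq> 0"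
    and F: "little_o_pow F (n - 1)" "little_o_pow (\<lambda>h. \<Sum>k. u k * F (q ^ k * h)) n"
  shows "little_o_pow F n"
proof -
  define P where "P = Abs_poly u"
  have P: "coeff P = u"
    unfolding P_def using fin by (intro Abs_poly_inverse) (simp add: MOST_iff_cofinite)
  have poly_P: "poly P z = (\<Sum>k. u k * z ^ k)" for z
    unfolding poly_altdef P[symmetric]
    by (rule suminf_finite[symmetric]) (auto simp: coeff_eq_0)
  \<comment> \<open>The point \<open>\<bar>q\<bar> ^ n\<close> belongs to the annulus, so the
    absence of roots there excludes P = 0.\<close>
  have pow: "\<bar>q\<bar> ^ n = \<bar>q\<bar> * \<bar>q\<bar> ^ (n - 1)"
    using n by (simp flip: power_Suc)
  have "cmod (complex_of_real (\<bar>q\<bar> ^ n)) = \<bar>q\<bar> ^ n"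
    unfolding norm_of_real by simp
  then have "complex_of_real (\<bar>q\<bar> ^ n) \<in> annulus q n"
    using q unfolding annulus_def by (auto simp del: of_real_power simp: pow)
  then have "P \<noteq> 0"
    using roots poly_P by (metis poly_0)
  moreover have "little_o_pow (dilation_poly q P F) n"
    using F(2) by (simp add: dilation_poly_def[abs_def] P)
  ultimately show ?thesis
    using little_o_pow_dilation_polyD[OF q n _ _ F(1)] roots by (simp add: poly_P)
qed

section \<open>Eigenfunctions of the dilation\<close>

text \<open>The function is a complex power of \<open>\<bar>h\<bar>\<close> times a sign: dilation
  by q raises ln |h| / ln |q| by 1 and hence multiplies the exponential by z'.\<close>

lemma dilation_eigenfunction:
  fixes q :: real and z \<tau> :: complex
  assumes q: "q \<notin> {0, 1, -1}" and z: "z \<noteq> 0" and \<tau>: "\<tau> \<in> {1, -1}"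
  obtains f :: "real \<Rightarrow> complex" where
    "f 0 = 0" "\<And>h. f (q * h) = z * f h" "\<And>h. f (- h) = \<tau> * f h"
    "\<And>h. h \<noteq> 0 \<Longrightarrow> cmod (f h) = \<bar>h\<bar> powr (ln (cmod z) / ln \<bar>q\<bar>)"
proof -
  define \<sigma> where "\<sigma> h = (if h < 0 then \<tau> else 1)" for h :: real
  have \<sigma>: "\<sigma> h * \<sigma> h = 1" "cmod (\<sigma> h) = 1" "\<sigma> h \<noteq> 0" for h
    using \<tau> by (auto simp: \<sigma>_def)
  have \<sigma>_mult: "\<sigma> (x * y) = \<sigma> x * \<sigma> y" if "x \<noteq> 0" "y \<noteq> 0" for x y
    using \<tau> that by (auto simp: \<sigma>_def mult_less_0_iff)
  \<comment> \<open>For negative q and \<tau> = -1 the dilation also flips the sign factor;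
    \<open>\<sigma> q\<close> compensates for this because its square is 1.\<close>
  define z' where "z' = \<sigma> q * z"
  have z': "z' \<noteq> 0" "cmod z' = cmod z"
    using z \<sigma> by (auto simp: z'_def norm_mult)
  have lnq: "ln \<bar>q\<bar> \<noteq> 0" using q by auto
  define f where "f h = (if h = 0 then 0
      else \<sigma> h * exp (of_real (ln \<bar>h\<bar> / ln \<bar>q\<bar>) * Ln z'))" for h
  show ?thesis
  proof
    show "f 0 = 0" by (simp add: f_def)
    show "f (q * h) = z * f h" for h
    proof (cases "h = 0")
      case False
      have "ln \<bar>q * h\<bar> / ln \<bar>q\<bar> = 1 + ln \<bar>h\<bar> / ln \<bar>q\<bar>"
        using q False lnq by (simp add: abs_mult ln_mult add_divide_distrib)
      then have "f (q * h) = (\<sigma> q * \<sigma> h) * (z' * exp (of_real (ln \<bar>h\<bar> / ln \<bar>q\<bar>) * Ln z'))"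
        using q False z' by (simp add: f_def \<sigma>_mult distrib_right exp_add)
      also have "\<dots> = (\<sigma> q * \<sigma> q) * z * f h"
        using False by (simp add: f_def z'_def mult_ac)
      finally show ?thesis by (simp add: \<sigma>)
    qed (simp add: f_def)
    show "f (- h) = \<tau> * f h" for h
      using \<sigma>_mult[of "-1" h] by (auto simp: f_def \<sigma>_def)
    show "cmod (f h) = \<bar>h\<bar> powr (ln (cmod z) / ln \<bar>q\<bar>)" if "h \<noteq> 0" for h
      using that z' z \<sigma> by (simp add: f_def norm_mult powr_def mult.commute)
  qed
qed

text \<open>Logarithms turn the annulus into an interval of exponents. For |q| < 1 the division by
  ln |q| < 0 reverses the inequalities, so both branches give the same half-open interval.\<close>

lemma annulus_exponent:
  assumes q: "q \<notin> {0, 1, -1}" and z: "z \<in> annulus q n"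
  shows "z \<noteq> 0" "real (n - 1) < ln (cmod z) / ln \<bar>q\<bar>" "ln (cmod z) / ln \<bar>q\<bar> \<le> real n"
proof -
  have pos: "\<bar>q\<bar> ^ k > 0" for k using q by simp
  show nz: "z \<noteq> 0"
    using z pos[of n] pos[of "n - 1"] unfolding annulus_def
    by (smt (verit) mem_Collect_eq norm_zero)
  have ln_pow: "ln (\<bar>q\<bar> ^ k) = real k * ln \<bar>q\<bar>" for k
    using q by (simp add: ln_realpow)
  show "real (n - 1) < ln (cmod z) / ln \<bar>q\<bar>"
  proof (cases "\<bar>q\<bar> > 1")
    case True
    then have "ln (\<bar>q\<bar> ^ (n - 1)) < ln (cmod z)"
      using z nz pos by (subst ln_less_cancel_iff) (auto simp: annulus_def)
    with True show ?thesis by (simp add: ln_pow less_divide_eq)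
  next
    case False
    then have "ln (cmod z) < ln (\<bar>q\<bar> ^ (n - 1))"
      using z nz pos by (subst ln_less_cancel_iff) (auto simp: annulus_def)
    moreover have "ln \<bar>q\<bar> < 0" using False q by auto
    ultimately show ?thesis by (simp add: ln_pow less_divide_eq)
  qed
  show "ln (cmod z) / ln \<bar>q\<bar> \<le> real n"
  proof (cases "\<bar>q\<bar> > 1")
    case True
    then have "ln (cmod z) \<le> ln (\<bar>q\<bar> ^ n)"
      using z nz pos by (subst ln_le_cancel_iff) (auto simp: annulus_def)
    with True show ?thesis by (simp add: ln_pow divide_le_eq)
  next
    case False
    then have "ln (\<bar>q\<bar> ^ n) \<le> ln (cmod z)"
      using z nz pos by (subst ln_le_cancel_iff) (auto simp: annulus_def)
    moreover have "ln \<bar>q\<bar> < 0" using False q by auto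
    ultimately show ?thesis by (simp add: ln_pow divide_le_eq)
  qed
qed

lemma little_o_pow_powr:
  assumes "\<And>h. h \<noteq> 0 \<Longrightarrow> cmod (f h) = \<bar>h\<bar> powr \<alpha>"
  shows "little_o_pow f m \<longleftrightarrow> real m < \<alpha>"
proof -
  have *: "cmod (f h) / \<bar>h\<bar> ^ m = \<bar>h\<bar> powr (\<alpha> - m)" if "h \<noteq> 0" for h
    using that assms by (simp add: powr_diff powr_realpow)
  have "little_o_pow f m \<longleftrightarrow> ((\<lambda>h::real. \<bar>h\<bar> powr (\<alpha> - m)) \<longlongrightarrow> 0) (at 0)"
    unfolding little_o_pow_def using * by (intro tendsto_cong) (auto simp: eventually_at_filter)
  also have "\<dots> \<longleftrightarrow> real m < \<alpha>"
  proof
    assume lim: "((\<lambda>h::real. \<bar>h\<bar> powr (\<alpha> - m)) \<longlongrightarrow> 0) (at 0)"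
    show "real m < \<alpha>"
    proof (rule ccontr)
      assume "\<not> real m < \<alpha>"
      then have "1 \<le> \<bar>h\<bar> powr (\<alpha> - m)" if "h \<noteq> 0" "\<bar>h\<bar> < 1" for h :: real
        using that powr_mono'[of "\<alpha> - m" 0 "\<bar>h\<bar>"] by simp
      then have "\<forall>\<^sub>F h::real in at 0. 1 \<le> \<bar>h\<bar> powr (\<alpha> - m)"
        unfolding eventually_at by (intro exI[of _ 1]) (auto simp: dist_real_def)
      from tendsto_lowerbound[OF lim this] show False by simp
    qed
  next
    assume "real m < \<alpha>"
    have "((\<lambda>h::real. \<bar>h\<bar>) \<longlongrightarrow> 0) (at 0)"
      using tendsto_rabs[OF tendsto_ident_at[of "0::real" UNIV]] by simp
    then show "((\<lambda>h::real. \<bar>h\<bar> powr (\<alpha> - m)) \<longlongrightarrow> 0) (at 0)"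
      by (rule tendsto_zero_powrI[OF _ tendsto_const]) (use \<open>real m < \<alpha>\<close> in auto)
  qed
  finally show ?thesis .
qed

section \<open>Necessity and sufficiency of the root condition\<close>

text \<open>\<tau> = 1 treats \<open>r_plus\<close> and even functions, \<tau> = -1 treats
  \<open>r_minus\<close> and odd ones. On the eigenfunction f the operator acts as multiplication by
  the value at z, which is 0, while f is o(h^(n-1)) but not o(h^n).\<close>

lemma not_MZ_property_of_root:
  fixes q :: real and \<tau> :: complex
  assumes q: "q \<notin> {0, 1, -1}" and \<tau>: "\<tau> \<in> {1, -1}"
    and z: "z \<in> annulus q n" and root: "(\<Sum>k. (a k + \<tau> * b k) * z ^ k) = 0"
    and fin: "finite {k. a k \<noteq> 0}" "finite {k. b k \<noteq> 0}"
  shows "\<not> MZ_property (diff_op q c a b) n"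
proof -
  note z_props = annulus_exponent[OF q z]
  obtain f :: "real \<Rightarrow> complex" where f: "f 0 = 0" "\<And>h. f (q * h) = z * f h"
      "\<And>h. f (- h) = \<tau> * f h"
    and mod_f: "\<And>h. h \<noteq> 0 \<Longrightarrow> cmod (f h) = \<bar>h\<bar> powr (ln (cmod z) / ln \<bar>q\<bar>)"
    using dilation_eigenfunction[OF q z_props(1) \<tau>] by blast
  have pow: "f (q ^ k * h) = z ^ k * f h" for k h
    by (induction k) (simp_all add: f mult.assoc)
  have fin_sum: "finite {k. a k + \<tau> * b k \<noteq> 0}"
    by (rule finite_subset[OF _ finite_UnI[OF fin]]) auto
  have "diff_op q c a b f h = (\<Sum>k. (a k + \<tau> * b k) * z ^ k * f h)" for h
    unfolding diff_op_def f pow by (simp add: ring_distribs mult_ac)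
  also have "\<dots> h = (\<Sum>k. (a k + \<tau> * b k) * z ^ k) * f h" for h
    by (rule suminf_mult2[symmetric, OF summable_finite_support[OF fin_sum]])
  finally have "diff_op q c a b f = (\<lambda>_. 0)"
    using root by auto
  then have "little_o_pow (diff_op q c a b f) n"
    by (simp add: little_o_pow_def)
  moreover have "little_o_pow f (n - 1)" "\<not> little_o_pow f n"
    using z_props little_o_pow_powr[OF mod_f] by auto
  ultimately show ?thesis
    unfolding MZ_property_def by blast
qed

lemma MZ_property_of_no_roots:
  fixes q :: real
  assumes q: "q \<notin> {0, 1, -1}" and n: "n \<ge> 1"
    and fin: "finite {k. a k \<noteq> 0}" "finite {k. b k \<noteq> 0}"
    and plus: "\<And>z. z \<in> annulus q n \<Longrightarrow> r_plus a b z \<noteq> 0"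
    and minus: "\<And>z. z \<in> annulus q n \<Longrightarrow> r_minus a b z \<noteq> 0"
  shows "MZ_property (diff_op q c a b) n"
  unfolding MZ_property_def
proof (intro allI impI, elim conjE)
  fix f :: "real \<Rightarrow> complex"
  assume f: "little_o_pow f (n - 1)" and Df: "little_o_pow (diff_op q c a b f) n"
  define S where "S h = (\<Sum>k. a k * f (q ^ k * h) + b k * f (- (q ^ k * h)))" for h
  define A where "A = {k. a k \<noteq> 0} \<union> {k. b k \<noteq> 0}"
  have A: "finite A" "\<And>k. k \<notin> A \<Longrightarrow> a k = 0 \<and> b k = 0"
    using fin by (auto simp: A_def)
  have S_eq: "S = (\<lambda>h. \<Sum>k\<in>A. a k * f (q ^ k * h) + b k * f (- (q ^ k) * h))"
    unfolding S_def using A by (intro ext, subst suminf_finite[OF A(1)]) auto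
  have D_eq: "diff_op q c a b f h = c * f 0 + S h" for h
    by (simp add: diff_op_def S_def)
  \<comment> \<open>Comparing D f with S at order n - 1, where all dilates of f are under control,
    leaves only the constant \<open>c * f 0\<close>.\<close>
  have "little_o_pow S (n - 1)"
    unfolding S_eq using q f
    by (intro little_o_pow_sum little_o_pow_add little_o_pow_cmult little_o_pow_scale) auto
  moreover have "little_o_pow (diff_op q c a b f) (n - 1)"
    using little_o_pow_mono[OF Df] by simp
  ultimately have "little_o_pow (\<lambda>_. c * f 0) (n - 1)"
    using little_o_pow_diff[of "diff_op q c a b f" "n - 1" S] by (simp add: D_eq)
  txt \<open>The condition \<open>little_o_pow f (n - 1)\<close> says nothing about \<open>f 0\<close>, so this has to be derived.\<close>
  then have "c * f 0 = 0" by (rule little_o_pow_constD)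
  with Df have S: "little_o_pow S n"
    using D_eq by (metis (no_types, lifting) add_0 ext)
  have S_neg: "little_o_pow (\<lambda>h. S (- h)) n"
    using little_o_pow_scale[OF S, of "-1"] by simp
  have f_neg: "little_o_pow (\<lambda>h. f (- h)) (n - 1)"
    using little_o_pow_scale[OF f, of "-1"] by simp

  \<comment> \<open>f(h) + \<tau> f(-h) is twice the even or odd part of f. Since \<tau>^2 = 1,
    expanding the product gives exactly the summands of S at h and, weighted by \<tau>, at
    -h.\<close>
  have split: "(\<Sum>k. (a k + \<tau> * b k) * (f (q ^ k * h) + \<tau> * f (- (q ^ k * h)))) = S h + \<tau> * S (- h)"
    if "\<tau> \<in> {1, -1}" for \<tau> h
  proof -
    have "(\<Sum>k. (a k + \<tau> * b k) * (f (q ^ k * h) + \<tau> * f (- (q ^ k * h)))) =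
        (\<Sum>k\<in>A. (a k + \<tau> * b k) * (f (q ^ k * h) + \<tau> * f (- (q ^ k * h))))"
      using A by (intro suminf_finite) auto
    also have "\<dots> = S h + \<tau> * S (- h)"
      unfolding S_eq sum_distrib_left sum.distrib[symmetric]
      using that by (intro sum.cong refl) (auto simp: algebra_simps)
    finally show ?thesis .
  qed
  have part: "little_o_pow (\<lambda>h. f h + \<tau> * f (- h)) n"
    if \<tau>: "\<tau> \<in> {1, -1}"
      and roots: "\<And>z. z \<in> annulus q n \<Longrightarrow> (\<Sum>k. (a k + \<tau> * b k) * z ^ k) \<noteq> 0" for \<tau>
  proof (rule little_o_pow_of_dilation_sum[OF q n _ roots])
    show "finite {k. a k + \<tau> * b k \<noteq> 0}"
      by (rule finite_subset[OF _ A(1)]) (auto simp: A_def)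
    show "little_o_pow (\<lambda>h. f h + \<tau> * f (- h)) (n - 1)"
      by (intro little_o_pow_add little_o_pow_cmult f f_neg)
    show "little_o_pow (\<lambda>h. \<Sum>k. (a k + \<tau> * b k) * (f (q ^ k * h) + \<tau> * f (- (q ^ k * h)))) n"
      unfolding split[OF \<tau>] by (intro little_o_pow_add little_o_pow_cmult S S_neg)
  qed
  have "little_o_pow (\<lambda>h. f h + f (- h)) n" "little_o_pow (\<lambda>h. f h - f (- h)) n"
    using part[of 1] part[of "-1"] plus minus by (simp_all add: r_plus_def r_minus_def)
  from little_o_pow_cmult[OF little_o_pow_add[OF this], of "1 / 2"]
  show "little_o_pow f n" by simp
qed

theorem corollary13:
  fixes q :: real and n :: nat and a b :: "nat \<Rightarrow> complex" and c :: complex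
  assumes "q \<notin> {0, 1, -1}"
    and "n \<ge> 1"
    and "finite {k. a k \<noteq> 0}"
    and "finite {k. b k \<noteq> 0}"
    and "c = - (\<Sum>k. a k + b k)"
  shows "MZ_property (diff_op q c a b) n \<longleftrightarrow>
    \<not> (\<exists>z \<in> annulus q n. r_plus a b z = 0 \<or> r_minus a b z = 0)"
  \<comment> \<open>The two instances \<tau> = 1 and \<tau> = -1 cover roots of
    \<open>r_plus\<close> and of \<open>r_minus\<close>.\<close>
  using MZ_property_of_no_roots[OF assms(1-4)]
    not_MZ_property_of_root[OF assms(1) _ _ _ assms(3,4), of 1]
    not_MZ_property_of_root[OF assms(1) _ _ _ assms(3,4), of "-1"]
  by (auto simp: r_plus_def r_minus_def)

end
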